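(* Let $0<r<1$ and let $T$ be a bounded operator on a complex Hilbert space. Then $T\in C_{1,r}$ if and only if $r^{-1/2}T\in\mathbb{Q}\mathbb{A}_{\sqrt r}$. Also, $T\in\mathbb{Q}\mathbb{A}_r$ if and only if $rT\in C_{1,r^2}$.
   Context: For $0<s<1$: $C_{1,s}$ is the class of invertible bounded operators $T$ on complex Hilbert spaces with $\|T\|\le1$ and $\|sT^{-1}\|\le1$; the quantum annulus $\mathbb{Q}\mathbb{A}_s$ is the class of invertible bounded operators $T$ on complex Hilbert spaces with $\|sT\|\le1$ and $\|sT^{-1}\|\le1$. *)

theory Defs
  imports "HOL-Analysis.Operator_Norm"
begin

(* The real scalar multiplication and the norm are those of real_normed_vector;
   scaleR_scaleC and cinner_self tie them to the complex structure. Positivity and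
   definiteness of the inner product follow from cinner_self. The inner product
   is linear in its first argument. *)
class complex_inner = real_normed_vector +
  fixes scaleC :: "complex \<Rightarrow> 'a \<Rightarrow> 'a"  (infixr \<open>*\<^sub>C\<close> 75)
    and cinner :: "'a \<Rightarrow> 'a \<Rightarrow> complex"
  assumes scaleC_add_right: "a *\<^sub>C (x + y) = a *\<^sub>C x + a *\<^sub>C y"
    and scaleC_add_left: "(a + b) *\<^sub>C x = a *\<^sub>C x + b *\<^sub>C x"
    and scaleC_scaleC: "a *\<^sub>C b *\<^sub>C x = (a * b) *\<^sub>C x"
    and scaleC_one: "1 *\<^sub>C x = x"
    and scaleR_scaleC: "t *\<^sub>R x = complex_of_real t *\<^sub>C x"
    and cinner_commute: "cinner x y = cnj (cinner y x)"
    and cinner_add_left: "cinner (x + y) z = cinner x z + cinner y z"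
    and cinner_scaleC_left: "cinner (a *\<^sub>C x) y = a * cinner x y"
    and cinner_self: "cinner x x = complex_of_real ((norm x)\<^sup>2)"

class chilbert_space = complex_inner + complete_space

instantiation complex :: chilbert_space
begin

definition scaleC_complex :: "complex \<Rightarrow> complex \<Rightarrow> complex"
  where "scaleC_complex a x = a * x"

definition cinner_complex :: "complex \<Rightarrow> complex \<Rightarrow> complex"
  where "cinner_complex x y = x * cnj y"

instance
  by standard
    (auto simp: scaleC_complex_def cinner_complex_def algebra_simps scaleR_conv_of_real
      complex_mult_cnj cmod_power2)

end

definition bounded_clinear :: "('a::complex_inner \<Rightarrow> 'b::complex_inner) \<Rightarrow> bool"
  where "bounded_clinear T \<longleftrightarrow> bounded_linear T \<and> (\<forall>c x. T (c *\<^sub>C x) = c *\<^sub>C T x)"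

definition invertible_bounded :: "('a::chilbert_space \<Rightarrow> 'a) \<Rightarrow> bool"
  where "invertible_bounded T \<longleftrightarrow> bounded_clinear T \<and> bij T \<and> bounded_clinear (inv T)"

definition class_C1 :: "real \<Rightarrow> ('a::chilbert_space \<Rightarrow> 'a) set"
  where "class_C1 s =
    {T. invertible_bounded T \<and> onorm T \<le> 1 \<and> onorm (\<lambda>x. s *\<^sub>R inv T x) \<le> 1}"

definition quantum_annulus :: "real \<Rightarrow> ('a::chilbert_space \<Rightarrow> 'a) set"
  where "quantum_annulus s =
    {T. invertible_bounded T \<and> onorm (\<lambda>x. s *\<^sub>R T x) \<le> 1 \<and> onorm (\<lambda>x. s *\<^sub>R inv T x) \<le> 1}"

end

theory Submission
  imports Defs
begin

text \<open>For nonzero real \<open>c\<close>, the operator \<open>c T\<close> is invertible exactly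
  when \<open>T\<close> is, and its inverse is \<open>T\<close> inverse divided by \<open>c\<close>
  (\<open>inv_scaleR_invertible\<close>, \<open>invertible_bounded_scaleR_iff\<close>). Both classes
  only bound the norms of multiples of \<open>T\<close> and of its inverse, so scaling by
  \<open>c\<close> merely changes the two coefficients. The lemmas
  \<open>scaleR_mem_quantum_annulus_iff\<close> and \<open>scaleR_mem_class_C1_iff\<close> record
  the new coefficients, and both equivalences reduce to arithmetic on them.\<close>

lemma bounded_clinear_scaleR:
  assumes "bounded_clinear T"
  shows "bounded_clinear (\<lambda>x. c *\<^sub>R T x)"
proof -
  have "c *\<^sub>R T (a *\<^sub>C x) = a *\<^sub>C (c *\<^sub>R T x)" for a x
    using assms by (simp add: bounded_clinear_def scaleR_scaleC scaleC_scaleC mult.commute)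
  then show ?thesis
    using assms bounded_linear_const_scaleR[of T c] by (simp add: bounded_clinear_def)
qed

lemma inv_scaleR_invertible:
  assumes "invertible_bounded T" and "c \<noteq> 0"
  shows "inv (\<lambda>x. c *\<^sub>R T x) = (\<lambda>x. inverse c *\<^sub>R inv T x)"
proof (rule inv_unique_comp)
  have T: "bij T" "bounded_linear T" "bounded_linear (inv T)"
    using assms(1) by (auto simp: invertible_bounded_def bounded_clinear_def)
  \<comment> \<open>Linearity of \<open>T\<close> moves \<open>inverse c\<close> out of
    \<open>T\<close>, where it cancels \<open>c\<close>; the other composition uses linearity of
    \<open>inv T\<close> in the same way.\<close>
  show "(\<lambda>x. c *\<^sub>R T x) \<circ> (\<lambda>x. inverse c *\<^sub>R inv T x) = id"
    using assms(2) T
    by (auto simp: fun_eq_iff linear_scale[OF bounded_linear.linear[OF T(2)]] bij_is_surj surj_f_inv_f)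
  show "(\<lambda>x. inverse c *\<^sub>R inv T x) \<circ> (\<lambda>x. c *\<^sub>R T x) = id"
    using assms(2) T
    by (auto simp: fun_eq_iff linear_scale[OF bounded_linear.linear[OF T(3)]] bij_is_inj inv_f_f)
qed

lemma invertible_bounded_scaleR:
  assumes "invertible_bounded T" and "c \<noteq> 0"
  shows "invertible_bounded (\<lambda>x. c *\<^sub>R T x)"
proof -
  have "bij (\<lambda>x. c *\<^sub>R x :: 'a)"
    by (rule o_bij[where g = "\<lambda>x. inverse c *\<^sub>R x"]) (use assms(2) in auto)
  then have "bij (\<lambda>x. c *\<^sub>R T x)"
    using assms(1) bij_comp[of T "\<lambda>x. c *\<^sub>R x"] by (simp add: invertible_bounded_def comp_def)
  then show ?thesis
    using assms by (auto simp: invertible_bounded_def inv_scaleR_invertible[OF assms]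
        intro: bounded_clinear_scaleR)
qed

text \<open>The converse holds because scaling \<open>c T\<close> by \<open>inverse c\<close> gives
  back \<open>T\<close>.\<close>

lemma invertible_bounded_scaleR_iff:
  assumes "c \<noteq> 0"
  shows "invertible_bounded (\<lambda>x. c *\<^sub>R T x) \<longleftrightarrow> invertible_bounded T"
  using invertible_bounded_scaleR[of T c] assms
    invertible_bounded_scaleR[of "\<lambda>x. c *\<^sub>R T x" "inverse c"]
  by auto

lemma scaleR_mem_quantum_annulus_iff:
  assumes "c \<noteq> 0"
  shows "(\<lambda>x. c *\<^sub>R T x) \<in> quantum_annulus s \<longleftrightarrow> invertible_bounded T \<and>
    onorm (\<lambda>x. (s * c) *\<^sub>R T x) \<le> 1 \<and> onorm (\<lambda>x. (s / c) *\<^sub>R inv T x) \<le> 1"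
  using assms
  by (auto simp: quantum_annulus_def invertible_bounded_scaleR_iff inv_scaleR_invertible
      divide_inverse)

lemma scaleR_mem_class_C1_iff:
  assumes "c \<noteq> 0"
  shows "(\<lambda>x. c *\<^sub>R T x) \<in> class_C1 s \<longleftrightarrow> invertible_bounded T \<and>
    onorm (\<lambda>x. c *\<^sub>R T x) \<le> 1 \<and> onorm (\<lambda>x. (s / c) *\<^sub>R inv T x) \<le> 1"
  using assms
  by (auto simp: class_C1_def invertible_bounded_scaleR_iff inv_scaleR_invertible
      divide_inverse)

theorem lemma1p5:
  fixes r :: real and T :: "'a::chilbert_space \<Rightarrow> 'a"
  assumes "0 < r" and "r < 1" and "bounded_clinear T"
  shows "(T \<in> class_C1 r \<longleftrightarrow> (\<lambda>x. (r powr (-1/2)) *\<^sub>R T x) \<in> quantum_annulus (sqrt r)) \<and>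
         (T \<in> quantum_annulus r \<longleftrightarrow> (\<lambda>x. r *\<^sub>R T x) \<in> class_C1 (r\<^sup>2))"
proof
  have c: "r powr (-1/2) = inverse (sqrt r)"
    using assms(1) by (simp add: powr_minus powr_half_sqrt)
  \<comment> \<open>These are \<open>s * c\<close> and \<open>s / c\<close> for
    \<open>s = sqrt r\<close> and \<open>c = r powr (-1/2)\<close>; the values 1 and
    \<open>r\<close> are the coefficients in \<open>class_C1 r\<close>.\<close>
  have "sqrt r * r powr (-1/2) = 1" and "sqrt r / r powr (-1/2) = r"
    unfolding c using assms(1) by (simp_all add: field_simps)
  then show "T \<in> class_C1 r \<longleftrightarrow> (\<lambda>x. (r powr (-1/2)) *\<^sub>R T x) \<in> quantum_annulus (sqrt r)"
    using assms(1) by (subst scaleR_mem_quantum_annulus_iff) (auto simp: class_C1_def)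
  \<comment> \<open>Here \<open>c = r\<close> and \<open>s / c\<close> is the square of
    \<open>r\<close> divided by \<open>r\<close>, so both coefficients equal \<open>r\<close>, as in
    \<open>quantum_annulus r\<close>.\<close>
  show "T \<in> quantum_annulus r \<longleftrightarrow> (\<lambda>x. r *\<^sub>R T x) \<in> class_C1 (r\<^sup>2)"
    using assms(1)
    by (subst scaleR_mem_class_C1_iff) (auto simp: quantum_annulus_def power2_eq_square)
qed

end
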